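(* Let $t_0<t_1<\cdots<t_J$ be selected correction instants in $I$. Assume $u_\rho^+\ge\delta>0$ a.e. in $\Omega\times I$. Define $$M_\rho^j:=\int_\Omega u_\rho^+(x,t_j)\,dx,\qquad M^j:=\int_\Omega u^*(x,t_j)\,dx=\int_\Omega u^*(x,0)\,dx .$$ Then $M_\rho^j\ge\delta|\Omega|>0$, and hence the scaling factor $\gamma^j:=M^j/M_\rho^j$ is well defined. Let $\gamma(t)$ be an interpolation of $\{\gamma^j\}_{j=0}^J$ (so $\gamma(t_j)=\gamma^j$) and define $\tilde u_\rho(x,t):=\gamma(t)u_\rho^+(x,t)$. Then $$\int_\Omega\tilde u_\rho(x,t_j)\,dx=\int_\Omega u^*(x,t_j)\,dx,\qquad j=0,\dots,J.$$
   Context: $\Omega$ is a bounded domain and $I$ a bounded time interval. $u^*$ is the exact concentration, whose mass $\int_\Omega u^*(x,t)\,dx$ is independent of $t$ (mass conservation). $u_\rho^+=\max\{u_\rho,\delta\}$ is the value-level positivity cut-off of a raw randomized-neural-network output $u_\rho$ (a finite linear combination of continuous functions on $\overline{\Omega\times I}$), so that $u_\rho^+(\cdot,t_j)$ is well defined, integrable, and at least $\delta$ at each $t_j$. *)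

theory Defs
  imports "HOL-Analysis.Analysis"
begin

text \<open>
  Space-time functions take a pair \<open>(x, t)\<close>, so that continuity on \<open>closure (\<Omega> \<times> I)\<close> and
  statements holding almost everywhere in \<open>\<Omega> \<times> I\<close> refer to the product space.
\<close>

definition bounded_domain :: "'a::euclidean_space set \<Rightarrow> bool" where
  "bounded_domain \<Omega> \<longleftrightarrow> open \<Omega> \<and> connected \<Omega> \<and> \<Omega> \<noteq> {} \<and> bounded \<Omega>"

text \<open>
  Of a randomized neural network only its form as a finite linear combination of continuous
  features matters; the features \<open>\<phi> k\<close> are the (frozen) hidden-layer functions.
\<close>

definition network_output ::
    "'a::euclidean_space set \<Rightarrow> real set \<Rightarrow> ('a \<times> real \<Rightarrow> real) \<Rightarrow> bool" where
  "network_output \<Omega> I u \<longleftrightarrow>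
     (\<exists>(m::nat) (c :: nat \<Rightarrow> real) (\<phi> :: nat \<Rightarrow> 'a \<times> real \<Rightarrow> real).
        (\<forall>k<m. continuous_on (closure (\<Omega> \<times> I)) (\<phi> k)) \<and>
        (\<forall>z \<in> closure (\<Omega> \<times> I). u z = (\<Sum>k<m. c k * \<phi> k z)))"

definition cutoff :: "real \<Rightarrow> ('a \<times> real \<Rightarrow> real) \<Rightarrow> 'a \<times> real \<Rightarrow> real" where
  "cutoff \<delta> u = (\<lambda>z. max (u z) \<delta>)"

definition mass :: "'a::euclidean_space set \<Rightarrow> ('a \<times> real \<Rightarrow> real) \<Rightarrow> real \<Rightarrow> real" where
  "mass \<Omega> u t = (LINT x:\<Omega>|lebesgue. u (x, t))"

text \<open>
  The initial time \<open>0\<close> is included separately because the time interval may be open at \<open>0\<close>.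
  Integrability is required explicitly since the Bochner integral of a non-integrable
  function is \<open>0\<close> by convention.
\<close>

definition mass_conserving ::
    "'a::euclidean_space set \<Rightarrow> real set \<Rightarrow> ('a \<times> real \<Rightarrow> real) \<Rightarrow> bool" where
  "mass_conserving \<Omega> I u \<longleftrightarrow>
     (\<forall>t \<in> insert 0 I. set_integrable lebesgue \<Omega> (\<lambda>x. u (x, t))) \<and>
     (\<forall>s \<in> insert 0 I. \<forall>t \<in> insert 0 I. mass \<Omega> u s = mass \<Omega> u t)"

definition scaling_factor ::
    "'a::euclidean_space set \<Rightarrow> ('a \<times> real \<Rightarrow> real) \<Rightarrow> ('a \<times> real \<Rightarrow> real) \<Rightarrow> real \<Rightarrow> real" where
  "scaling_factor \<Omega> u v t = mass \<Omega> u t / mass \<Omega> v t"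

definition rescaled :: "(real \<Rightarrow> real) \<Rightarrow> ('a \<times> real \<Rightarrow> real) \<Rightarrow> 'a \<times> real \<Rightarrow> real" where
  "rescaled \<gamma> v = (\<lambda>(x, t). \<gamma> t * v (x, t))"

end

theory Submission
  imports Defs
begin

text \<open>
  Two facts carry the result. First, at a fixed time the cut-off is a continuous function of
  space on the compact set \<open>closure \<Omega>\<close>, hence integrable over \<open>\<Omega>\<close>
  (\<open>cutoff_slice_integrable\<close>). Integrability is what turns the bound \<open>cutoff \<delta> u \<ge> \<delta>\<close>
  into a bound on the mass (\<open>mass_cutoff_ge\<close>): otherwise the Bochner integral would be \<open>0\<close> by
  convention. As a nonempty open bounded set has positive finite measure, the
  mass is nonzero and the scaling factor is a genuine quotient. Second, the factor \<open>\<gamma> t\<close> does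
  not depend on \<open>x\<close>, so it leaves the spatial integral (\<open>mass_rescaled\<close>) and cancels the
  denominator of the scaling factor.
\<close>

lemma continuous_on_network_output:
  assumes "network_output \<Omega> I u"
  shows "continuous_on (closure (\<Omega> \<times> I)) u"
proof -
  obtain m :: nat and c \<phi>
    where \<phi>: "\<forall>k<m. continuous_on (closure (\<Omega> \<times> I)) (\<phi> k)"
      and u: "\<forall>z \<in> closure (\<Omega> \<times> I). u z = (\<Sum>k<m. c k * \<phi> k z)"
    using assms unfolding network_output_def by blast
  have "continuous_on (closure (\<Omega> \<times> I)) (\<lambda>z. \<Sum>k<m. c k * \<phi> k z)"
    using \<phi> by (intro continuous_intros) auto
  then show ?thesis
    using u by (simp cong: continuous_on_cong)
qed

text \<open>
  Continuity up to the boundary is essential: a function that is continuous only on the open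
  set \<open>\<Omega>\<close> need not be integrable there.
\<close>

lemma cutoff_slice_integrable:
  fixes \<Omega> :: "'a::euclidean_space set"
  assumes "open \<Omega>" and "bounded \<Omega>"
    and cont: "continuous_on (closure (\<Omega> \<times> I)) u" and "s \<in> I"
  shows "set_integrable lebesgue \<Omega> (\<lambda>x. cutoff \<delta> u (x, s))"
proof -
  have "(\<lambda>x. (x, s)) ` closure \<Omega> \<subseteq> closure (\<Omega> \<times> I)"
    using \<open>s \<in> I\<close> closure_subset[of I] by (auto simp: closure_Times)
  then have "continuous_on (closure \<Omega>) (\<lambda>x. u (x, s))"
    by (intro continuous_on_compose2[OF cont] continuous_intros)
  then have "continuous_on (closure \<Omega>) (\<lambda>x. cutoff \<delta> u (x, s))"
    unfolding cutoff_def by (intro continuous_intros)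
  moreover have "compact (closure \<Omega>)"
    using \<open>bounded \<Omega>\<close> by simp
  ultimately have
    "integrable lborel (\<lambda>x. indicator (closure \<Omega>) x *\<^sub>R cutoff \<delta> u (x, s))"
    by (intro borel_integrable_compact)
  then have "set_integrable lebesgue (closure \<Omega>) (\<lambda>x. cutoff \<delta> u (x, s))"
    unfolding set_integrable_def
    by (simp add: integrable_completion borel_measurable_integrable)
  then show ?thesis
    by (rule set_integrable_subset) (use \<open>open \<Omega>\<close> closure_subset in auto)
qed

lemma mass_cutoff_ge:
  fixes \<Omega> :: "'a::euclidean_space set"
  assumes "\<Omega> \<in> lmeasurable"
    and "set_integrable lebesgue \<Omega> (\<lambda>x. cutoff \<delta> u (x, s))"
  shows "\<delta> * measure lebesgue \<Omega> \<le> mass \<Omega> (cutoff \<delta> u) s"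
proof -
  have "set_integrable lebesgue \<Omega> (\<lambda>x. \<delta>)"
    using assms(1) by (simp add: set_integrable_def lmeasurable_iff_integrable)
  then have "(LINT x:\<Omega>|lebesgue. \<delta>) \<le> mass \<Omega> (cutoff \<delta> u) s"
    unfolding mass_def using assms(2)
    by (rule set_integral_mono) (simp add: cutoff_def)
  then show ?thesis
    using assms(1)
    by (simp add: set_lebesgue_integral_def fmeasurable_def mult.commute)
qed

lemma mass_rescaled: "mass \<Omega> (rescaled \<gamma> v) s = \<gamma> s * mass \<Omega> v s"
  by (simp add: mass_def rescaled_def)

lemma measure_lebesgue_bounded_domain_pos:
  fixes \<Omega> :: "'a::euclidean_space set"
  assumes "bounded_domain \<Omega>"
  shows "0 < measure lebesgue \<Omega>"
proof -
  have "open \<Omega>" "\<Omega> \<noteq> {}" "\<Omega> \<in> lmeasurable"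
    using assms by (auto simp: bounded_domain_def lmeasurable_open)
  then show ?thesis
    using open_not_negligible negligible_iff_measure zero_less_measure_iff by blast
qed

theorem proposition3p15:
  fixes \<Omega> :: "'a::euclidean_space set"
    and I :: "real set"
    and u_star u_rho :: "'a \<times> real \<Rightarrow> real"
    and \<delta> :: real
    and J :: nat
    and t :: "nat \<Rightarrow> real"
  assumes "bounded_domain \<Omega>"
    and "is_interval I" and "bounded I"
    and "mass_conserving \<Omega> I u_star"
    and "network_output \<Omega> I u_rho"
    and "strict_mono_on {..J} t"
    and "\<forall>j\<le>J. t j \<in> I"
    and "\<delta> > 0"
    and "AE z in lebesgue_on (\<Omega> \<times> I). cutoff \<delta> u_rho z \<ge> \<delta>"
  shows "\<delta> * measure lebesgue \<Omega> > 0 \<and>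
    (\<forall>j\<le>J. mass \<Omega> u_star (t j) = mass \<Omega> u_star 0 \<and>
           mass \<Omega> (cutoff \<delta> u_rho) (t j) \<ge> \<delta> * measure lebesgue \<Omega> \<and>
           mass \<Omega> (cutoff \<delta> u_rho) (t j) \<noteq> 0) \<and>
    (\<forall>\<gamma> :: real \<Rightarrow> real.
       (\<forall>j\<le>J. \<gamma> (t j) = scaling_factor \<Omega> u_star (cutoff \<delta> u_rho) (t j)) \<longrightarrow>
       (\<forall>j\<le>J. mass \<Omega> (rescaled \<gamma> (cutoff \<delta> u_rho)) (t j) = mass \<Omega> u_star (t j)))"
proof (intro conjI allI impI)
  have dom: "open \<Omega>" "bounded \<Omega>" "\<Omega> \<in> lmeasurable"
    using \<open>bounded_domain \<Omega>\<close> by (auto simp: bounded_domain_def lmeasurable_open)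
  show pos: "\<delta> * measure lebesgue \<Omega> > 0"
    using \<open>\<delta> > 0\<close> measure_lebesgue_bounded_domain_pos[OF \<open>bounded_domain \<Omega>\<close>] by simp
  show lower: "mass \<Omega> (cutoff \<delta> u_rho) (t j) \<ge> \<delta> * measure lebesgue \<Omega>" if "j \<le> J" for j
    using that \<open>\<forall>j\<le>J. t j \<in> I\<close> dom
      continuous_on_network_output[OF \<open>network_output \<Omega> I u_rho\<close>]
    by (intro mass_cutoff_ge cutoff_slice_integrable) auto
  show nonzero: "mass \<Omega> (cutoff \<delta> u_rho) (t j) \<noteq> 0" if "j \<le> J" for j
    using lower[OF that] pos by linarith
  show "mass \<Omega> u_star (t j) = mass \<Omega> u_star 0" if "j \<le> J" for j
    using that \<open>\<forall>j\<le>J. t j \<in> I\<close> \<open>mass_conserving \<Omega> I u_star\<close>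
    unfolding mass_conserving_def by blast
  show "mass \<Omega> (rescaled \<gamma> (cutoff \<delta> u_rho)) (t j) = mass \<Omega> u_star (t j)"
    if "\<forall>j\<le>J. \<gamma> (t j) = scaling_factor \<Omega> u_star (cutoff \<delta> u_rho) (t j)" and "j \<le> J"
    for \<gamma> j
    using that nonzero[OF \<open>j \<le> J\<close>] by (simp add: mass_rescaled scaling_factor_def)
qed

end
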